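(* Let $X$ be a self-similar graph with respect to $F$ and $\psi$ satisfying Axiom (S1) (stated in the context). Then $X$ is bipartite if and only if some cell graph is bipartite. Furthermore, $\theta=2$ if $X$ is bipartite.
   Context: Graphs $X=(VX,EX)$ are undirected, without loops or multiple edges. The boundary $\theta C$ of $C\subset VX$ is the set of vertices in $VX\setminus C$ which are adjacent to some vertex in $C$, and $\hat C$ denotes the subgraph of $X$ spanned by $C\cup\theta C$. For $F\subset VX$ let $\mathcal C_X(F)$ be the set of connected components of $VX\setminus F$. The reduced graph $X_F$ has vertex set $VX_F=F$, and two vertices $x,y\in F$ are joined by an edge of $X_F$ if and only if there is a component $C\in\mathcal C_X(F)$ such that $x,y\in\theta C$. A connected infinite graph $X$ is self-similar with respect to $F\subset VX$ and $\psi:VX\to VX_F$ if (F1) no vertices in $F$ are adjacent in $X$; (F2) the intersection of the boundaries of two different components in $\mathcal C_X(F)$ contains not more than one vertex; (F3) $\psi$ is an isomorphism between $X$ and $X_F$. The components in $\mathcal C_X(F)$ are called cells, and for a cell $C$ the graph $\hat C$ is called its cell graph. Axiom (S1): all cells are finite, and for any pair of cells $C,D\in\mathcal C_X(F)$ there exists an isomorphism $\alpha$ of $\hat C$ and $\hat D$ such that $\alpha(\theta C)=\theta D$. Under (S1), $\theta$ (as a number) denotes the number of vertices in the boundary of a cell, which is independent of the choice of the cell. *)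

theory Defs
  imports "Graph_Theory.Graph_Theory"
begin

text \<open>
  Undirected graphs without loops or multiple edges are rendered as symmetric, loop-free
  relations on a possibly infinite vertex set, i.e. by \<^locale>\<open>pair_bidirected_digraph\<close>
  (unlike \<^locale>\<open>pair_graph\<close>, it does not assume finiteness).
\<close>

definition bipartite :: "('a, 'b) pre_digraph \<Rightarrow> bool" where
  "bipartite G \<longleftrightarrow> (\<exists>A B. A \<union> B = verts G \<and> A \<inter> B = {} \<and>
     (\<forall>u v. u \<rightarrow>\<^bsub>G\<^esub> v \<longrightarrow> (u \<in> A \<and> v \<in> B) \<or> (u \<in> B \<and> v \<in> A)))"

text \<open>
  Without multiple edges an isomorphism is determined by its action on the vertices, so the
  arc maps carried along by \<^const>\<open>digraph_iso\<close> are not needed.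
\<close>

definition graph_isomorphism ::
    "('a \<Rightarrow> 'c) \<Rightarrow> ('a, 'b) pre_digraph \<Rightarrow> ('c, 'd) pre_digraph \<Rightarrow> bool" where
  "graph_isomorphism f G H \<longleftrightarrow> bij_betw f (verts G) (verts H) \<and>
     (\<forall>u\<in>verts G. \<forall>v\<in>verts G. u \<rightarrow>\<^bsub>G\<^esub> v \<longleftrightarrow> f u \<rightarrow>\<^bsub>H\<^esub> f v)"

definition boundary :: "'a pair_pre_digraph \<Rightarrow> 'a set \<Rightarrow> 'a set" where
  "boundary X C = {v \<in> pverts X - C. \<exists>u\<in>C. u \<rightarrow>\<^bsub>with_proj X\<^esub> v}"

text \<open>
  In a symmetric digraph the strongly connected components are the connected components.
\<close>

definition cells :: "'a pair_pre_digraph \<Rightarrow> 'a set \<Rightarrow> 'a set set" where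
  "cells X F = pre_digraph.sccs_verts (with_proj X \<restriction> (pverts X - F))"

definition cell_graph :: "'a pair_pre_digraph \<Rightarrow> 'a set \<Rightarrow> ('a, 'a \<times> 'a) pre_digraph" where
  "cell_graph X C = with_proj X \<restriction> (C \<union> boundary X C)"

definition reduced_graph :: "'a pair_pre_digraph \<Rightarrow> 'a set \<Rightarrow> 'a pair_pre_digraph" where
  "reduced_graph X F = \<lparr> pverts = F,
     parcs = {(x, y). x \<in> F \<and> y \<in> F \<and> x \<noteq> y \<and>
                (\<exists>C\<in>cells X F. x \<in> boundary X C \<and> y \<in> boundary X C)} \<rparr>"

locale self_similar_graph = pair_bidirected_digraph X
  for X :: "'a pair_pre_digraph" +
  fixes F :: "'a set" and \<psi> :: "'a \<Rightarrow> 'a"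
  assumes conn: "connected (with_proj X)"
    and infinite_pverts: "infinite (pverts X)"
    and F_subset: "F \<subseteq> pverts X"
    and F1: "\<And>x y. x \<in> F \<Longrightarrow> y \<in> F \<Longrightarrow> \<not> x \<rightarrow>\<^bsub>with_proj X\<^esub> y"
    and F2: "\<And>C D x y. C \<in> cells X F \<Longrightarrow> D \<in> cells X F \<Longrightarrow> C \<noteq> D \<Longrightarrow>
               x \<in> boundary X C \<inter> boundary X D \<Longrightarrow> y \<in> boundary X C \<inter> boundary X D \<Longrightarrow> x = y"
    and F3: "graph_isomorphism \<psi> (with_proj X) (with_proj (reduced_graph X F))"

definition axiom_S1 :: "'a pair_pre_digraph \<Rightarrow> 'a set \<Rightarrow> bool" where
  "axiom_S1 X F \<longleftrightarrow> (\<forall>C\<in>cells X F. finite C) \<and>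
     (\<forall>C\<in>cells X F. \<forall>D\<in>cells X F. \<exists>\<alpha>.
        graph_isomorphism \<alpha> (cell_graph X C) (cell_graph X D) \<and>
        \<alpha> ` boundary X C = boundary X D)"

end

theory Submission
  imports Defs
begin

text \<open>
  The edges of the reduced graph are pairs of boundary vertices of a common cell, so a cell with
  three boundary vertices puts a triangle into the reduced graph, hence into \<open>X\<close>, and, as no two
  vertices of \<open>F\<close> are adjacent, into some cell graph. If one (hence every) cell graph is bipartite,
  cells thus have at most two boundary vertices, and by (S1) these have equal colours in all cells
  or different colours in all cells. A closed walk avoiding \<open>F\<close> stays in one cell and is even.
  Otherwise base it at a vertex of \<open>F\<close>, let \<open>n > 0\<close> be its length, and record its successive
  visits to \<open>F\<close>. This gives a closed walk of length \<open>m \<le> n div 2\<close> in the reduced graph, with \<open>n\<close>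
  even in the first case and \<open>n \<equiv> m\<close> modulo 2 in the second. As \<open>X\<close> is isomorphic to its reduced
  graph, a shortest odd closed walk would lead to a shorter one.
\<close>

section \<open>Arcs, colourings and walks\<close>

lemma arcs_ends_induce_subgraph_with_proj:
  "u \<rightarrow>\<^bsub>with_proj X \<restriction> S\<^esub> v \<longleftrightarrow> (u, v) \<in> parcs X \<and> u \<in> S \<and> v \<in> S"
  by (auto simp: arcs_ends_conv image_iff)

text \<open>Colours on all of the type suffice: well-formedness keeps the ends of arcs among the
  vertices, so a colouring can be cut down to a partition of \<open>verts G\<close>.\<close>

lemma bipartite_iff_colouring:
  assumes "wf_digraph G"
  shows "bipartite G \<longleftrightarrow> (\<exists>c :: 'a \<Rightarrow> bool. \<forall>u v. u \<rightarrow>\<^bsub>G\<^esub> v \<longrightarrow> c u \<noteq> c v)"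
proof
  assume "bipartite G"
  then obtain A B where "A \<inter> B = {}"
    "\<forall>u v. u \<rightarrow>\<^bsub>G\<^esub> v \<longrightarrow> (u \<in> A \<and> v \<in> B) \<or> (u \<in> B \<and> v \<in> A)"
    unfolding bipartite_def by blast
  then have "\<forall>u v. u \<rightarrow>\<^bsub>G\<^esub> v \<longrightarrow> (u \<in> A) \<noteq> (v \<in> A)" by blast
  then show "\<exists>c :: 'a \<Rightarrow> bool. \<forall>u v. u \<rightarrow>\<^bsub>G\<^esub> v \<longrightarrow> c u \<noteq> c v"
    by (rule exI[of _ "\<lambda>v. v \<in> A"])
next
  assume "\<exists>c :: 'a \<Rightarrow> bool. \<forall>u v. u \<rightarrow>\<^bsub>G\<^esub> v \<longrightarrow> c u \<noteq> c v"
  then obtain c :: "'a \<Rightarrow> bool" where c: "\<And>u v. u \<rightarrow>\<^bsub>G\<^esub> v \<Longrightarrow> c u \<noteq> c v" by blast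
  show "bipartite G"
    unfolding bipartite_def
  proof (intro exI conjI allI impI)
    fix u v assume "u \<rightarrow>\<^bsub>G\<^esub> v"
    then show "(u \<in> {v \<in> verts G. c v} \<and> v \<in> {v \<in> verts G. \<not> c v}) \<or>
        (u \<in> {v \<in> verts G. \<not> c v} \<and> v \<in> {v \<in> verts G. c v})"
      using c[of u v] wf_digraph.adj_in_verts[OF assms] by auto
  qed auto
qed

lemma reachable_imp_relpow:
  assumes "u \<rightarrow>\<^sup>*\<^bsub>G\<^esub> v"
  shows "\<exists>n. (u, v) \<in> arcs_ends G ^^ n"
  using rtrancl_on_rtranclI assms unfolding reachable_def
  by (metis rtrancl_power)

lemma relpow_sym:
  assumes "sym R" "(x, y) \<in> R ^^ n"
  shows "(y, x) \<in> R ^^ n"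
  using assms(2)
proof (induction n arbitrary: y)
  case (Suc n)
  then obtain z where "(x, z) \<in> R ^^ n" "(z, y) \<in> R" by auto
  then show ?case using Suc.IH assms(1) by (meson relpow_Suc_I2 symE)
qed auto

context self_similar_graph
begin

section \<open>Cells and their boundaries\<close>

lemma arc_imp_not_both_in_F: "(u, v) \<in> parcs X \<Longrightarrow> u \<notin> F \<or> v \<notin> F"
  using F1 by auto

lemma wf_cell_graph: "wf_digraph (cell_graph X C)"
  unfolding cell_graph_def by (rule wellformed_induce_subgraph)

lemma arcs_ends_cell_graph:
  "u \<rightarrow>\<^bsub>cell_graph X C\<^esub> v \<longleftrightarrow>
     (u, v) \<in> parcs X \<and> u \<in> C \<union> boundary X C \<and> v \<in> C \<union> boundary X C"
  unfolding cell_graph_def arcs_ends_induce_subgraph_with_proj ..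

text \<open>A walk can leave a cell only through \<open>F\<close>: outside \<open>F\<close> the arc
  and its reverse survive in the induced subgraph, so both ends share a strong component.\<close>

lemma arc_from_cell_cases:
  assumes "C \<in> cells X F" "u \<in> C" "(u, v) \<in> parcs X"
  shows "if v \<in> F then v \<in> boundary X C else v \<in> C"
proof -
  let ?H = "with_proj X \<restriction> (pverts X - F)"
  interpret H: wf_digraph ?H by (rule wellformed_induce_subgraph)
  have C: "C \<in> pre_digraph.sccs_verts ?H" using assms(1) by (simp add: cells_def)
  then have sub: "C \<subseteq> pverts X - F" using H.sccs_verts_subsets by force
  show ?thesis
  proof (cases "v \<in> F")
    case True
    then show ?thesis using assms sub F_subset by (auto simp: boundary_def)
  next
    case False
    have "u \<rightarrow>\<^bsub>?H\<^esub> v" "v \<rightarrow>\<^bsub>?H\<^esub> u"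
      using assms sub False in_arcsD2 arcs_symmetric
      by (auto simp: arcs_ends_induce_subgraph_with_proj)
    then have "v \<in> C"
      using C assms(2) unfolding H.in_sccs_verts_conv_reachable
      by (meson H.reachable_adjI)
    with False show ?thesis by simp
  qed
qed

lemma boundary_subset_F:
  assumes "C \<in> cells X F"
  shows "boundary X C \<subseteq> F"
proof
  fix v assume "v \<in> boundary X C"
  then obtain u where "v \<notin> C" "u \<in> C" "(u, v) \<in> parcs X" by (auto simp: boundary_def)
  then show "v \<in> F" using arc_from_cell_cases[OF assms] by (metis (full_types))
qed

lemma obtain_cell:
  assumes "u \<in> pverts X" "u \<notin> F"
  obtains C where "C \<in> cells X F" "u \<in> C"
proof -
  let ?H = "with_proj X \<restriction> (pverts X - F)"
  interpret H: wf_digraph ?H by (rule wellformed_induce_subgraph)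
  have "u \<in> verts ?H" using assms by simp
  then show thesis
    using that[of "H.scc_of u"] H.scc_of_in_sccs_verts H.in_scc_of_self by (simp add: cells_def)
qed

section \<open>Connectedness\<close>

lemma walk_exists:
  assumes "u \<in> pverts X" "v \<in> pverts X"
  shows "\<exists>n. (u, v) \<in> parcs X ^^ n"
proof -
  \<comment> \<open>\<open>connected\<close> speaks of the symmetric closure, whose reachability is
    that of \<open>X\<close> because \<open>X\<close> is already symmetric.\<close>
  have "u \<rightarrow>\<^sup>*\<^bsub>with_proj X\<^esub> v"
    using assms conn reachable_mk_symmetric_eq[OF pair_sym_arcs]
    by (auto simp: connected_def strongly_connected_def)
  then show ?thesis using reachable_imp_relpow by fastforce
qed

lemma arcs_nonempty: "\<exists>u v. (u, v) \<in> parcs X"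
proof -
  obtain u where u: "u \<in> pverts X" using infinite_pverts by fastforce
  obtain v where v: "v \<in> pverts X" "v \<noteq> u"
    using infinite_pverts by (metis finite.simps insert_iff subsetI finite_subset)
  obtain n where "(u, v) \<in> parcs X ^^ n"
    using walk_exists u v by blast
  with v show ?thesis by (cases n) auto
qed

section \<open>Pulling back from the reduced graph; triangles\<close>

lemma reduced_graph_arc_preimage:
  assumes "(x, y) \<in> parcs (reduced_graph X F)"
  shows "(inv_into (pverts X) \<psi> x, inv_into (pverts X) \<psi> y) \<in> parcs X"
proof -
  have bij: "bij_betw \<psi> (pverts X) F"
    using F3 by (simp add: graph_isomorphism_def reduced_graph_def)
  have "x \<in> F" "y \<in> F" using assms by (auto simp: reduced_graph_def)
  then show ?thesis
    using F3 assms bij_betw_inv_into_right[OF bij] bij_betwE[OF bij_betw_inv_into[OF bij]]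
    by (simp add: graph_isomorphism_def)
qed

text \<open>Length and closedness survive the pullback, which is what the descent on odd closed
  walks requires.\<close>

lemma reduced_graph_walk_preimage:
  assumes "(x, y) \<in> parcs (reduced_graph X F) ^^ n"
  shows "(inv_into (pverts X) \<psi> x, inv_into (pverts X) \<psi> y) \<in> parcs X ^^ n"
  using assms
  by (induction n arbitrary: y) (auto intro: reduced_graph_arc_preimage)

lemma triangle_of_three_boundary_vertices:
  assumes "C \<in> cells X F" "{x, y, z} \<subseteq> boundary X C" "x \<noteq> y" "y \<noteq> z" "z \<noteq> x"
  obtains u v w where "(u, v) \<in> parcs X" "(v, w) \<in> parcs X" "(w, u) \<in> parcs X"
proof -
  have "(x, y) \<in> parcs (reduced_graph X F)" "(y, z) \<in> parcs (reduced_graph X F)"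
    "(z, x) \<in> parcs (reduced_graph X F)"
    using assms boundary_subset_F[OF assms(1)] by (auto simp: reduced_graph_def)
  then show thesis using that by (blast dest: reduced_graph_arc_preimage)
qed

text \<open>One of \<open>u\<close>, \<open>v\<close> lies outside \<open>F\<close>; the cell around
  it, together with its boundary, contains all its neighbours, hence the triangle.\<close>

lemma triangle_in_cell_graph:
  assumes "(u, v) \<in> parcs X" "(v, w) \<in> parcs X" "(w, u) \<in> parcs X"
  shows "\<exists>C\<in>cells X F. {u, v, w} \<subseteq> C \<union> boundary X C"
proof -
  have sub: "\<exists>C\<in>cells X F. {x, y, z} \<subseteq> C \<union> boundary X C"
    if xyz: "(x, y) \<in> parcs X" "(x, z) \<in> parcs X" "x \<notin> F" for x y z
  proof -
    obtain C where "C \<in> cells X F" "x \<in> C" using obtain_cell[of x] xyz in_arcsD1 by blast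
    then show ?thesis using arc_from_cell_cases[of C x] xyz by (metis UnCI empty_subsetI insert_subset)
  qed
  show ?thesis
  proof (cases "u \<in> F")
    case False
    then show ?thesis using sub[of u v w] assms arcs_symmetric by blast
  next
    case True
    then have "v \<notin> F" using assms arc_imp_not_both_in_F by blast
    then show ?thesis using sub[of v u w] assms arcs_symmetric by (simp add: insert_commute)
  qed
qed

section \<open>Parity of closed walks\<close>

text \<open>Vertices are coloured by the parity of walks from a root \<open>r\<close>. Two walks of
  different parity to the same vertex would join to an odd closed walk.\<close>

lemma bipartite_if_no_odd_closed_walk:
  assumes "\<And>x n. (x, x) \<in> parcs X ^^ n \<Longrightarrow> even n"
  shows "bipartite (with_proj X)"
proof -
  obtain r where r: "r \<in> pverts X" using infinite_pverts by fastforce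
  have sym: "sym (parcs X)" using arcs_symmetric by (auto intro: symI)
  define c where "c v \<longleftrightarrow> (\<exists>n. even n \<and> (r, v) \<in> parcs X ^^ n)" for v
  have c: "c v \<longleftrightarrow> even n" if "(r, v) \<in> parcs X ^^ n" for v n
  proof -
    have "even (n + m)" if "(r, v) \<in> parcs X ^^ m" for m
    proof (rule assms)
      show "(r, r) \<in> parcs X ^^ (n + m)"
        unfolding relpow_add using \<open>(r, v) \<in> parcs X ^^ n\<close> relpow_sym[OF sym that] by blast
    qed
    then have "even n = even m" if "(r, v) \<in> parcs X ^^ m" for m using that by simp
    then show ?thesis using that unfolding c_def by blast
  qed
  have "c u \<noteq> c v" if uv: "(u, v) \<in> parcs X" for u v
  proof -
    obtain n where n: "(r, u) \<in> parcs X ^^ n"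
      using walk_exists r uv in_arcsD1 by blast
    then have "(r, v) \<in> parcs X ^^ Suc n" using uv by auto
    then show ?thesis using c n by (metis even_Suc)
  qed
  then show ?thesis
    unfolding bipartite_iff_colouring[OF wf_digraph_axioms] with_proj_simps by blast
qed

text \<open>Until it meets \<open>F\<close> the walk stays in \<open>C\<close> and switches colour
  at each step. Otherwise it is split at a visit to \<open>F\<close>, so that a closed walk can be
  based there.\<close>

lemma walk_in_cell_or_through_F:
  assumes proper: "\<And>C u v. C \<in> cells X F \<Longrightarrow> u \<rightarrow>\<^bsub>cell_graph X C\<^esub> v \<Longrightarrow> c C u \<noteq> (c C v :: bool)"
    and C: "C \<in> cells X F" "x \<in> C"
    and walk: "(x, v) \<in> parcs X ^^ n"
  shows "(v \<in> C \<and> even n = (c C x = c C v)) \<or>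
    (\<exists>z\<in>F. \<exists>k\<le>n. (x, z) \<in> parcs X ^^ k \<and> (z, v) \<in> parcs X ^^ (n - k))"
  using walk
proof (induction n arbitrary: v)
  case 0
  then show ?case using C by simp
next
  case (Suc n)
  then obtain u where u: "(x, u) \<in> parcs X ^^ n" "(u, v) \<in> parcs X" by auto
  from Suc.IH[OF u(1)] show ?case
  proof
    assume *: "u \<in> C \<and> even n = (c C x = c C u)"
    show ?thesis
    proof (cases "v \<in> F")
      case True
      \<comment> \<open>The walk has just entered \<open>F\<close>: the split is at its end, with an
        empty second part.\<close>
      then show ?thesis using Suc.prems by (intro disjI2 bexI[of _ v] exI[of _ "Suc n"]) auto
    next
      case False
      then have "v \<in> C" using arc_from_cell_cases[OF C(1)] * u(2) by metis
      moreover from this have "c C u \<noteq> c C v"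
        using proper[OF C(1)] * u(2) by (simp add: arcs_ends_cell_graph)
      ultimately show ?thesis using * by auto
    qed
  next
    assume "\<exists>z\<in>F. \<exists>k\<le>n. (x, z) \<in> parcs X ^^ k \<and> (z, u) \<in> parcs X ^^ (n - k)"
    then obtain z k where "z \<in> F" "k \<le> n" "(x, z) \<in> parcs X ^^ k" "(z, u) \<in> parcs X ^^ (n - k)"
      by blast
    then show ?thesis
      using u(2) by (intro disjI2 bexI[of _ z] exI[of _ k]) (auto simp: Suc_diff_le)
  qed
qed

text \<open>
  The bound \<open>2 * m + 1 \<le> n\<close> inside a cell reflects that a walk needs at least two steps
  between distinct vertices of \<open>F\<close>; the vertex \<open>z\<close> is the last visited vertex of \<open>F\<close>.
\<close>

lemma walk_from_F_reduces:
  assumes proper: "\<And>C u v. C \<in> cells X F \<Longrightarrow> u \<rightarrow>\<^bsub>cell_graph X C\<^esub> v \<Longrightarrow> c C u \<noteq> (c C v :: bool)"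
    and p: "\<And>C z w. C \<in> cells X F \<Longrightarrow> z \<in> boundary X C \<Longrightarrow> w \<in> boundary X C \<Longrightarrow> z \<noteq> w \<Longrightarrow>
      (c C z \<noteq> c C w) = p"
    and x: "x \<in> F"
    and walk: "(x, v) \<in> parcs X ^^ n"
  shows "if v \<in> F
    then \<exists>m. (x, v) \<in> parcs (reduced_graph X F) ^^ m \<and> 2 * m \<le> n \<and> even n = (even m \<or> \<not> p)
    else \<exists>C\<in>cells X F. v \<in> C \<and> (\<exists>z\<in>boundary X C. \<exists>m. (x, z) \<in> parcs (reduced_graph X F) ^^ m \<and>
      2 * m + 1 \<le> n \<and> even n = ((even m \<or> \<not> p) = (c C z = c C v)))"
  using walk
proof (induction n arbitrary: v)
  case 0
  then show ?case using x by simp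
next
  case (Suc n)
  then obtain u where u: "(x, u) \<in> parcs X ^^ n" "(u, v) \<in> parcs X" by auto
  note IH = Suc.IH[OF u(1)]
  show ?case
  proof (cases "u \<in> F")
    case True
    then have v: "v \<notin> F" using arc_imp_not_both_in_F u(2) by blast
    from True IH obtain m where m: "(x, u) \<in> parcs (reduced_graph X F) ^^ m" "2 * m \<le> n"
      "even n = (even m \<or> \<not> p)" by auto
    \<comment> \<open>The walk steps from \<open>F\<close> into \<open>C\<close>, so
      \<open>u\<close> becomes the last visited vertex of \<open>F\<close> and \<open>m\<close>
      stays unchanged.\<close>
    obtain C where C: "C \<in> cells X F" "v \<in> C" using obtain_cell[of v] v u(2) in_arcsD2 by blast
    have b: "u \<in> boundary X C"
      using arc_from_cell_cases[OF C] arcs_symmetric[OF u(2)] True by metis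
    have "c C u \<noteq> c C v" using proper[OF C(1)] b C u(2) by (simp add: arcs_ends_cell_graph)
    with m have "(x, u) \<in> parcs (reduced_graph X F) ^^ m \<and>
      2 * m + 1 \<le> Suc n \<and> even (Suc n) = ((even m \<or> \<not> p) = (c C u = c C v))" by auto
    with v C b show ?thesis by (simp only: if_False) blast
  next
    case False
    with IH obtain C z m where C: "C \<in> cells X F" "u \<in> C" and z: "z \<in> boundary X C"
      and m: "(x, z) \<in> parcs (reduced_graph X F) ^^ m" "2 * m + 1 \<le> n"
        "even n = ((even m \<or> \<not> p) = (c C z = c C u))" by auto
    have v: "if v \<in> F then v \<in> boundary X C else v \<in> C" using arc_from_cell_cases[OF C u(2)] .
    then have uv: "c C u \<noteq> c C v"
      using proper[OF C(1)] C u(2) by (auto simp: arcs_ends_cell_graph split: if_splits)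
    show ?thesis
    proof (cases "v \<in> F")
      case vF: False
      have "2 * m + 1 \<le> Suc n" "even (Suc n) = ((even m \<or> \<not> p) = (c C z = c C v))"
        using m uv by auto
      with vF v C z m(1) show ?thesis by (simp only: if_False) blast
    next
      case vF: True
      then have vb: "v \<in> boundary X C" using v by simp
      show ?thesis
      proof (cases "z = v")
        case True
        \<comment> \<open>The excursion returns to its starting point: it adds no reduced arc and
          has even length.\<close>
        then have "2 * m \<le> Suc n" "even (Suc n) = (even m \<or> \<not> p)" using m uv by auto
        with m(1) True vF show ?thesis by auto
      next
        case neq: False
        \<comment> \<open>An excursion between distinct boundary vertices adds one reduced arc; its
          length is odd exactly if \<open>p\<close> holds.\<close>
        have "(z, v) \<in> parcs (reduced_graph X F)"
          using neq z vb boundary_subset_F[OF C(1)] C(1) by (auto simp: reduced_graph_def)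
        then have "(x, v) \<in> parcs (reduced_graph X F) ^^ Suc m" using m(1) by auto
        moreover have "2 * Suc m \<le> Suc n" using m(2) by simp
        moreover have "even (Suc n) = (even (Suc m) \<or> \<not> p)"
          using m(3) uv p[OF C(1) z vb neq] by auto
        ultimately show ?thesis using vF by (simp only: if_True) blast
      qed
    qed
  qed
qed

lemma no_odd_closed_walk:
  assumes proper: "\<And>C u v. C \<in> cells X F \<Longrightarrow> u \<rightarrow>\<^bsub>cell_graph X C\<^esub> v \<Longrightarrow> c C u \<noteq> (c C v :: bool)"
    and p: "\<And>C z w. C \<in> cells X F \<Longrightarrow> z \<in> boundary X C \<Longrightarrow> w \<in> boundary X C \<Longrightarrow> z \<noteq> w \<Longrightarrow>
      (c C z \<noteq> c C w) = p"
    and walk: "(x, x) \<in> parcs X ^^ n"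
  shows "even n"
  using walk
proof (induction n arbitrary: x rule: less_induct)
  case (less n)
  have through_F: "even n" if z: "z \<in> F" "(z, z) \<in> parcs X ^^ n" for z
  proof (rule ccontr)
    assume "odd n"
    with walk_from_F_reduces[of c p, OF proper p z] z
    obtain m where m: "(z, z) \<in> parcs (reduced_graph X F) ^^ m" "2 * m \<le> n" "odd m" by auto
    \<comment> \<open>An odd \<open>m\<close> is positive, so halving the length makes it strictly
      smaller.\<close>
    then have "m < n" by (cases m) auto
    with less.IH reduced_graph_walk_preimage[OF m(1)] m(3) show False by blast
  qed
  show ?case
  proof (cases "x \<in> F \<or> n = 0")
    case True
    then show ?thesis using through_F less.prems by auto
  next
    case False
    then obtain y where "(x, y) \<in> parcs X"
      using less.prems relpow_Suc_D2 by (metis not0_implies_Suc)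
    then obtain C where C: "C \<in> cells X F" "x \<in> C" using False obtain_cell[of x] in_arcsD1 by blast
    from walk_in_cell_or_through_F[of c, OF proper C less.prems] show ?thesis
    proof
      assume "\<exists>z\<in>F. \<exists>k\<le>n. (x, z) \<in> parcs X ^^ k \<and> (z, x) \<in> parcs X ^^ (n - k)"
      then obtain z k where z: "z \<in> F" "k \<le> n"
        "(x, z) \<in> parcs X ^^ k" "(z, x) \<in> parcs X ^^ (n - k)" by blast
      \<comment> \<open>The closed walk is rotated so that it starts at \<open>z\<close> in
        \<open>F\<close>.\<close>
      then have "(z, z) \<in> parcs X ^^ (n - k + k)" unfolding relpow_add by blast
      with z show ?thesis using through_F by simp
    next
      assume "x \<in> C \<and> even n = (c C x = c C x)"
      then show ?thesis by (simp only: refl simp_thms)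
    qed
  qed
qed

section \<open>The equivalence and the boundary size\<close>

lemma bipartite_cell_graph:
  assumes "bipartite (with_proj X)"
  shows "bipartite (cell_graph X C)"
  using assms
  unfolding bipartite_iff_colouring[OF wf_digraph_axioms] bipartite_iff_colouring[OF wf_cell_graph]
    arcs_ends_cell_graph with_proj_simps by blast

lemma card_boundary_of_bipartite:
  assumes S1: "axiom_S1 X F" and bip: "bipartite (with_proj X)" and C: "C \<in> cells X F"
  shows "card (boundary X C) = 2"
proof -
  have no_triangle: "False" if "(u, v) \<in> parcs X" "(v, w) \<in> parcs X" "(w, u) \<in> parcs X" for u v w
    using bip that bipartite_iff_colouring[OF wf_digraph_axioms] unfolding with_proj_simps by metis
  \<comment> \<open>The image of an arc under \<open>\<psi>\<close> is a reduced arc, whose ends are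
    two boundary vertices of one cell. (S1) carries them to \<open>C\<close>, where a third would
    yield a triangle.\<close>
  obtain D x y where D: "D \<in> cells X F" "x \<in> boundary X D" "y \<in> boundary X D" "x \<noteq> y"
  proof -
    obtain u v where "(u, v) \<in> parcs X" using arcs_nonempty by blast
    then have "(\<psi> u, \<psi> v) \<in> parcs (reduced_graph X F)"
      using F3 in_arcsD1 in_arcsD2 unfolding graph_isomorphism_def with_proj_simps by blast
    then show thesis using that by (auto simp: reduced_graph_def)
  qed
  obtain \<alpha> where iso: "graph_isomorphism \<alpha> (cell_graph X D) (cell_graph X C)"
    and bd: "\<alpha> ` boundary X D = boundary X C"
    using S1 C D(1) unfolding axiom_S1_def by blast
  have "inj_on \<alpha> (D \<union> boundary X D)"
    using iso by (simp add: graph_isomorphism_def cell_graph_def bij_betw_def)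
  with D have ne: "\<alpha> x \<noteq> \<alpha> y" by (auto dest: inj_onD)
  have sub: "{\<alpha> x, \<alpha> y} \<subseteq> boundary X C" using bd D by blast
  have "z \<in> {\<alpha> x, \<alpha> y}" if "z \<in> boundary X C" for z
  proof (rule ccontr)
    assume "z \<notin> {\<alpha> x, \<alpha> y}"
    then show False
      using triangle_of_three_boundary_vertices[OF C, of "\<alpha> x" "\<alpha> y" z] ne sub that no_triangle
      by (metis insert_iff insert_subset empty_subsetI)
  qed
  with sub have "boundary X C = {\<alpha> x, \<alpha> y}" by blast
  with ne show ?thesis by simp
qed

lemma bipartite_of_bipartite_cell_graph:
  assumes S1: "axiom_S1 X F" and C: "C \<in> cells X F" and bip: "bipartite (cell_graph X C)"
  shows "bipartite (with_proj X)"
proof -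
  obtain c0 :: "'a \<Rightarrow> bool" where c0: "\<And>u v. u \<rightarrow>\<^bsub>cell_graph X C\<^esub> v \<Longrightarrow> c0 u \<noteq> c0 v"
    using bip bipartite_iff_colouring[OF wf_cell_graph] by blast
  have "\<forall>D\<in>cells X F. \<exists>\<alpha>. graph_isomorphism \<alpha> (cell_graph X D) (cell_graph X C) \<and>
      \<alpha> ` boundary X D = boundary X C"
    using S1 C unfolding axiom_S1_def by blast
  then obtain \<alpha> where
    iso: "\<And>D. D \<in> cells X F \<Longrightarrow> graph_isomorphism (\<alpha> D) (cell_graph X D) (cell_graph X C)"
    and bd: "\<And>D. D \<in> cells X F \<Longrightarrow> \<alpha> D ` boundary X D = boundary X C"
    by metis
  \<comment> \<open>The colour depends on the cell: colours of a boundary vertex shared by several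
    cells need not agree, as only colours within one cell are compared.\<close>
  define c where "c D v = c0 (\<alpha> D v)" for D v
  have proper: "c D u \<noteq> c D v" if D: "D \<in> cells X F" "u \<rightarrow>\<^bsub>cell_graph X D\<^esub> v" for D u v
  proof -
    have "\<alpha> D u \<rightarrow>\<^bsub>cell_graph X C\<^esub> \<alpha> D v"
      using iso[OF D(1)] D(2) wf_digraph.adj_in_verts[OF wf_cell_graph D(2)]
      unfolding graph_isomorphism_def by blast
    then show ?thesis unfolding c_def by (rule c0)
  qed
  have no_triangle: "False" if t: "(u, v) \<in> parcs X" "(v, w) \<in> parcs X" "(w, u) \<in> parcs X" for u v w
  proof -
    obtain D where "D \<in> cells X F" "{u, v, w} \<subseteq> D \<union> boundary X D"
      using triangle_in_cell_graph[OF t] by blast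
    then have "c D u \<noteq> c D v" "c D v \<noteq> c D w" "c D w \<noteq> c D u"
      using t proper by (auto simp: arcs_ends_cell_graph)
    then show False by blast
  qed
  \<comment> \<open>\<open>p\<close> records whether the boundary colours differ. With no third
    boundary vertex, any two distinct ones decide it, and the isomorphisms carry this to every
    cell.\<close>
  define p where "p \<longleftrightarrow> (\<exists>a\<in>boundary X C. \<exists>b\<in>boundary X C. c0 a \<noteq> c0 b)"
  have p0: "(c0 a \<noteq> c0 b) = p" if ab: "a \<in> boundary X C" "b \<in> boundary X C" "a \<noteq> b" for a b
  proof -
    have "z = a \<or> z = b" if "z \<in> boundary X C" for z
      using triangle_of_three_boundary_vertices[OF C, of a b z] ab that no_triangle
      by (metis insert_subset empty_subsetI)
    then show ?thesis unfolding p_def using ab by metis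
  qed
  have p: "(c D z \<noteq> c D w) = p"
    if D: "D \<in> cells X F" and zw: "z \<in> boundary X D" "w \<in> boundary X D" "z \<noteq> w" for D z w
  proof -
    have "inj_on (\<alpha> D) (D \<union> boundary X D)"
      using iso[OF D] by (simp add: graph_isomorphism_def cell_graph_def bij_betw_def)
    with zw have "\<alpha> D z \<noteq> \<alpha> D w" by (auto dest: inj_onD)
    then show ?thesis unfolding c_def using p0 bd[OF D] zw by blast
  qed
  show ?thesis
    by (rule bipartite_if_no_odd_closed_walk) (rule no_odd_closed_walk[of c p, OF proper p])
qed

text \<open>Supplies the witness for some cell graph being bipartite when \<open>X\<close> is: every
  arc has an end outside \<open>F\<close>.\<close>

lemma cells_nonempty: "cells X F \<noteq> {}"
proof -
  obtain u v where uv: "(u, v) \<in> parcs X" using arcs_nonempty by blast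
  then obtain w where "w \<in> pverts X" "w \<notin> F"
    using arc_imp_not_both_in_F in_arcsD1 in_arcsD2 by blast
  then show ?thesis using obtain_cell by blast
qed

end

theorem lemma2:
  fixes X :: "'a pair_pre_digraph" and F :: "'a set" and \<psi> :: "'a \<Rightarrow> 'a"
  assumes "self_similar_graph X F \<psi>" and "axiom_S1 X F"
  shows "(bipartite (with_proj X) \<longleftrightarrow> (\<exists>C\<in>cells X F. bipartite (cell_graph X C))) \<and>
         (bipartite (with_proj X) \<longrightarrow> (\<forall>C\<in>cells X F. card (boundary X C) = 2))"
proof -
  interpret self_similar_graph X F \<psi> by fact
  show ?thesis
    using assms(2) cells_nonempty bipartite_cell_graph card_boundary_of_bipartite
      bipartite_of_bipartite_cell_graph by blast
qed

end
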